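(* For every integer $n\ge 0$, the following identity of polynomials in $x$ and $y$ holds: $$\sum_{m=0}^n\frac{(-x)^{n-m}}{(n-m)!}R_m(x,y)=\frac1{n!}\sum_{k=0}^{\lfloor n/2\rfloor}\binom{n}{k}\binom{n+y-k}{n-2k}(n-k)!^2x^k,$$ where $$R_m(x,y)=\frac1{m!}\sum_{k=0}^m\binom{m}{k}\binom{m+y}{m-k}(m-k)!^2x^k.$$
   Context: Here $x,y$ are indeterminates over $\mathbb{Q}$, and for a polynomial $u$ and an integer $j\ge0$, $\binom{u}{j}=u(u-1)\cdots(u-j+1)/j!$. The notation $(n-k)!^2$ means $((n-k)!)^2$. *)

theory Defs
  imports "HOL-Computational_Algebra.Polynomial"
begin

text \<open>
  The ring of polynomials in two indeterminates over the rationals is \<^typ>\<open>rat poly poly\<close>: the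
  outer indeterminate is \<open>y\<close>, the inner one is \<open>x\<close>.
\<close>

definition cst :: "rat \<Rightarrow> rat poly poly" where
  "cst c = [:[:c:]:]"

definition X :: "rat poly poly" where
  "X = [:[:0, 1:]:]"

definition Y :: "rat poly poly" where
  "Y = [:0, 1:]"

text \<open>
  The binomial coefficient with a polynomial upper entry, \<open>u (u - 1) \<cdots> (u - j + 1) / j!\<close>. The
  library's \<open>gchoose\<close> is restricted to fields of characteristic zero and so does not apply here.
\<close>

definition pbinom :: "rat poly poly \<Rightarrow> nat \<Rightarrow> rat poly poly" where
  "pbinom u j = cst (1 / fact j) * (\<Prod>i<j. u - of_nat i)"

definition R :: "nat \<Rightarrow> rat poly poly" where
  "R m = cst (1 / fact m) *
     (\<Sum>k=0..m. of_nat (m choose k) * pbinom (of_nat m + Y) (m - k) * (fact (m - k))\<^sup>2 * X ^ k)"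

end

theory Submission
  imports Defs
begin

text \<open>
  Collecting the coefficient of \<open>x\<^sup>N\<close> on the left turns the sum into \<open>(n - N)! / N!\<close> times the
  \<open>N\<close>-th forward difference of \<open>u \<mapsto> pbinom u (n - N)\<close> at \<open>u = n - N + y\<close>. By Pascal's rule this
  difference is \<open>pbinom u (n - 2N)\<close>, or \<open>0\<close> if \<open>2N > n\<close>.
\<close>

lemma cst_mult: "cst (a * b) = cst a * cst b"
  by (simp add: cst_def)

lemma cst_of_nat: "cst (of_nat k) = of_nat k"
  by (simp add: cst_def of_nat_poly)

lemma cst_fact: "cst (fact k) = fact k"
  using cst_of_nat[of "fact k"] by simp

lemma cst_power: "cst (a ^ k) = cst a ^ k"
  by (induction k) (simp_all add: cst_mult, simp add: cst_def one_pCons)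

lemma pbinom_0: "pbinom u 0 = 1"
  by (simp add: pbinom_def cst_def one_pCons)

text \<open>The products for \<open>u + 1\<close> and \<open>u\<close> share the factor
  \<open>?P\<close>, with cofactors \<open>u + 1\<close> and \<open>u - of_nat j\<close>. These
  differ by \<open>j + 1\<close>, which cancels against \<open>fact (Suc j)\<close>.\<close>

lemma pbinom_Pascal: "pbinom (u + 1) (Suc j) - pbinom u (Suc j) = pbinom u j"
proof -
  let ?P = "\<Prod>i<j. u - of_nat i"
  have c: "cst (1 / fact j) = cst (1 / fact (Suc j)) * of_nat (Suc j)"
    unfolding cst_of_nat[symmetric] cst_mult[symmetric] by (simp add: field_simps del: of_nat_Suc)
  have "(\<Prod>i<Suc j. u + 1 - of_nat i) = (u + 1) * ?P"
    by (subst prod.lessThan_Suc_shift) simp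
  then have "pbinom (u + 1) (Suc j) - pbinom u (Suc j)
      = cst (1 / fact (Suc j)) * ((u + 1) * ?P - ?P * (u - of_nat j))"
    by (simp add: pbinom_def right_diff_distrib del: fact_Suc)
  also have "\<dots> = pbinom u j"
    unfolding pbinom_def c by (simp add: algebra_simps del: fact_Suc)
  finally show ?thesis .
qed

text \<open>Pascal's rule on \<open>Suc N choose i\<close> splits the sum in two. It makes a
  difference of order \<open>N + 1\<close> the \<open>N\<close>-th difference of the first
  difference, as the next induction needs.\<close>

lemma alternating_sum_Suc:
  fixes f :: "nat \<Rightarrow> 'a::comm_ring_1"
  shows "(\<Sum>i\<le>Suc N. (-1) ^ i * of_nat (Suc N choose i) * f (Suc N - i)) =
    (\<Sum>i\<le>N. (-1) ^ i * of_nat (N choose i) * (f (Suc (N - i)) - f (N - i)))"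
proof -
  let ?g = "\<lambda>i. (-1) ^ i * of_nat (N choose i) * f (Suc N - i)"
  have "(\<Sum>i\<le>Suc N. (-1) ^ i * of_nat (Suc N choose i) * f (Suc N - i)) =
      f (Suc N) + (\<Sum>i\<le>N. ?g (Suc i)) - (\<Sum>i\<le>N. (-1) ^ i * of_nat (N choose i) * f (N - i))"
    by (subst sum.atMost_Suc_shift)
      (simp add: sum.distrib sum_subtractf sum_negf algebra_simps)
  \<comment> \<open>\<open>f (Suc N)\<close> is the term \<open>?g 0\<close>. The top term
    \<open>?g (Suc N)\<close> vanishes because \<open>N choose Suc N\<close> is 0.\<close>
  also have "f (Suc N) + (\<Sum>i\<le>N. ?g (Suc i)) = (\<Sum>i\<le>Suc N. ?g i)"
    by (subst sum.atMost_Suc_shift) simp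
  also have "\<dots> = (\<Sum>i\<le>N. (-1) ^ i * of_nat (N choose i) * f (Suc (N - i)))"
    by (simp add: Suc_diff_le binomial_eq_0)
  finally show ?thesis
    by (simp add: right_diff_distrib sum_subtractf)
qed

text \<open>Each difference lowers \<open>j\<close> by one, so \<open>j\<close> must vary in the
  induction on \<open>N\<close>. Once the lower index is 0, the function is constantly 1 and further
  differences vanish.\<close>

lemma pbinom_difference:
  "(\<Sum>i\<le>N. (-1) ^ i * of_nat (N choose i) * pbinom (u + of_nat (N - i)) j) =
    (if N \<le> j then pbinom u (j - N) else 0)"
proof (induction N arbitrary: j)
  case 0
  then show ?case by simp
next
  case (Suc N)
  let ?f = "\<lambda>i. pbinom (u + of_nat i) j"
  have step: "(\<Sum>i\<le>Suc N. (-1) ^ i * of_nat (Suc N choose i) * ?f (Suc N - i)) =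
      (\<Sum>i\<le>N. (-1) ^ i * of_nat (N choose i) * (?f (Suc (N - i)) - ?f (N - i)))"
    by (rule alternating_sum_Suc)
  show ?case
  proof (cases j)
    case 0
    then show ?thesis unfolding step by (simp add: pbinom_0)
  next
    case (Suc l)
    have "?f (Suc i) - ?f i = pbinom (u + of_nat i) l" for i
      using pbinom_Pascal[of "u + of_nat i" l] by (simp add: Suc algebra_simps)
    then show ?thesis unfolding step by (simp only: Suc.IH) (simp add: Suc)
  qed
qed

text \<open>Here \<open>fact (n - i)\<close> and one \<open>fact (n - N)\<close> cancel, and
  \<open>1 / (fact i * fact (N - i))\<close> is \<open>N choose i\<close> over
  \<open>fact N\<close>. The factor \<open>P\<close> is arbitrary so that the case
  \<open>i = 0\<close> also serves for the right-hand side of the theorem.\<close>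

lemma X_coefficient:
  assumes "i \<le> N" "N \<le> n"
  shows "cst (1 / fact i) * (- X) ^ i * (cst (1 / fact (n - i)) * (of_nat ((n - i) choose (N - i))
      * P * (fact (n - N))\<^sup>2 * X ^ (N - i))) =
    cst (fact (n - N) / fact N) * X ^ N * ((-1) ^ i * of_nat (N choose i) * P)"
proof -
  have "of_nat ((n - i) choose (N - i)) = (fact (n - i) / (fact (N - i) * fact (n - N)) :: rat)"
    using assms by (subst binomial_fact) auto
  moreover have "of_nat (N choose i) = (fact N / (fact i * fact (N - i)) :: rat)"
    using assms by (subst binomial_fact) auto
  ultimately have "1 / fact i * (1 / fact (n - i)) * of_nat ((n - i) choose (N - i)) * (fact (n - N))\<^sup>2
      = (fact (n - N) / fact N * of_nat (N choose i) :: rat)"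
    by (simp only:) (simp add: field_simps power2_eq_square)
  \<comment> \<open>The cancellation took place in the field \<open>rat\<close>; multiplicativity of
    \<open>cst\<close> carries it to polynomials.\<close>
  then have c: "cst (1 / fact i) * cst (1 / fact (n - i)) * of_nat ((n - i) choose (N - i))
      * (fact (n - N))\<^sup>2 = cst (fact (n - N) / fact N) * of_nat (N choose i)"
    by (metis cst_mult cst_of_nat cst_fact cst_power)
  have "X ^ N = X ^ i * X ^ (N - i)"
    using assms by (simp flip: power_add)
  moreover have "(- X) ^ i = (-1) ^ i * X ^ i"
    by (rule power_minus)
  ultimately have "cst (1 / fact i) * (- X) ^ i * (cst (1 / fact (n - i))
      * (of_nat ((n - i) choose (N - i)) * P * (fact (n - N))\<^sup>2 * X ^ (N - i)))
    = (cst (1 / fact i) * cst (1 / fact (n - i)) * of_nat ((n - i) choose (N - i))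
      * (fact (n - N))\<^sup>2) * (X ^ N * (-1) ^ i * P)"
    by (simp add: mult_ac)
  then show ?thesis
    unfolding c by (simp add: mult_ac)
qed

theorem lemma3p1:
  fixes n :: nat
  shows "(\<Sum>m=0..n. cst (1 / fact (n - m)) * (- X) ^ (n - m) * R m) =
    cst (1 / fact n) *
      (\<Sum>k=0..n div 2. of_nat (n choose k) * pbinom (of_nat n + Y - of_nat k) (n - 2 * k)
         * (fact (n - k))\<^sup>2 * X ^ k)"
proof -
  let ?u = "\<lambda>N. of_nat n + Y - of_nat N"
  define g where "g i k = cst (1 / fact i) * (- X) ^ i * (cst (1 / fact (n - i))
      * (of_nat ((n - i) choose k) * pbinom (of_nat (n - i) + Y) (n - i - k)
      * (fact (n - i - k))\<^sup>2 * X ^ k))" for i k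
  define c where "c N = cst (fact (n - N) / fact N) * X ^ N" for N
  have "(\<Sum>m=0..n. cst (1 / fact (n - m)) * (- X) ^ (n - m) * R m) =
      (\<Sum>i\<le>n. cst (1 / fact i) * (- X) ^ i * R (n - i))"
    by (rule sum.reindex_bij_witness[of _ "\<lambda>i. n - i" "\<lambda>i. n - i"]) auto
  also have "\<dots> = (\<Sum>i\<le>n. \<Sum>k\<le>n - i. g i k)"
    by (simp add: R_def g_def sum_distrib_left atLeast0AtMost)
  also have "\<dots> = (\<Sum>(i, k)\<in>{(i, k). i + k \<le> n}. g i k)"
    by (subst sum.Sigma) (auto intro!: sum.cong)
  \<comment> \<open>Terms are grouped by the total power \<open>N = i + k\<close> of
    \<open>X\<close>.\<close>
  also have "\<dots> = (\<Sum>N\<le>n. \<Sum>i\<le>N. g i (N - i))"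
    by (rule sum.triangle_reindex_eq)
  also have "\<dots> = (\<Sum>N\<le>n. if N \<le> n div 2 then c N * pbinom (?u N) (n - 2 * N) else 0)"
  proof (rule sum.cong)
    fix N assume "N \<in> {..n}"
    then have N: "N \<le> n" by simp
    have "g i (N - i) = c N * ((-1) ^ i * of_nat (N choose i)
        * pbinom (?u N + of_nat (N - i)) (n - N))" if "i \<le> N" for i
    proof -
      \<comment> \<open>For fixed \<open>N\<close> the lower index is the same for all
        \<open>i\<close>, and the upper entries are the shifts of \<open>?u N\<close> by
        \<open>N - i\<close>: the shape of an \<open>N\<close>-th difference.\<close>
      have "of_nat (n - i) + Y = ?u N + of_nat (N - i)" "n - i - (N - i) = n - N"
        using that N by (simp_all add: of_nat_diff)
      then show ?thesis
        unfolding g_def c_def by (simp only: X_coefficient[OF that N])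
    qed
    then have "(\<Sum>i\<le>N. g i (N - i)) = c N * (if N \<le> n - N then pbinom (?u N) (n - N - N) else 0)"
      unfolding pbinom_difference[symmetric] sum_distrib_left by (intro sum.cong) auto
    moreover have "N \<le> n - N \<longleftrightarrow> N \<le> n div 2" "n - N - N = n - 2 * N"
      using N by auto
    ultimately show "(\<Sum>i\<le>N. g i (N - i)) =
        (if N \<le> n div 2 then c N * pbinom (?u N) (n - 2 * N) else 0)"
      by simp
  qed simp
  also have "\<dots> = (\<Sum>N=0..n div 2. c N * pbinom (?u N) (n - 2 * N))"
    by (rule sum.mono_neutral_cong_right) auto
  also have "\<dots> = cst (1 / fact n) * (\<Sum>k=0..n div 2. of_nat (n choose k) * pbinom (?u k) (n - 2 * k)
         * (fact (n - k))\<^sup>2 * X ^ k)"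
    unfolding sum_distrib_left
  proof (rule sum.cong)
    fix k assume "k \<in> {0..n div 2}"
    then have "k \<le> n" by simp
    \<comment> \<open>At \<open>i = 0\<close> the sign, the power of \<open>- X\<close> and
      \<open>k choose 0\<close> are all 1, leaving \<open>c k\<close> in its binomial form.\<close>
    from X_coefficient[of 0 k n "pbinom (?u k) (n - 2 * k)", OF _ this]
    show "c k * pbinom (?u k) (n - 2 * k) = cst (1 / fact n) *
        (of_nat (n choose k) * pbinom (?u k) (n - 2 * k) * (fact (n - k))\<^sup>2 * X ^ k)"
      by (simp add: c_def cst_def)
  qed simp
  finally show ?thesis .
qed

end
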